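(* If $R$ is a symmetric nonnegative real $n\times n$ matrix with maximum density $\kappa$ and $\alpha=\|R\|_1$, then $\lambda(R)\le2\sqrt{\kappa(\alpha-\kappa)}$.
   Context: $\lambda(R)$ is the largest eigenvalue (spectral radius) of $R$; $\|R\|_1$ is the maximum column sum. The maximum density of a nonnegative $n\times n$ matrix $R=(\varrho_{ij})$ is $\kappa(R)=\max_{\emptyset\ne I\subseteq[n]}\ \frac{1}{2|I|}\sum_{i,j\in I}\varrho_{ij}$. *)

theory Defs
  imports "Jordan_Normal_Form.Spectral_Radius"
begin

text \<open>Matrices are square, of positive dimension, and indexed from \<open>0\<close>: the index set
  \<open>[n]\<close> is rendered as \<open>{..<n}\<close>.\<close>

definition largest_eigenvalue :: "real mat \<Rightarrow> real" where
  "largest_eigenvalue R = Max (spectrum R)"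

text \<open>The matrix norm induced by the \<open>\<ell>\<^sup>1\<close> vector norm; for a nonnegative matrix the absolute
  values have no effect.\<close>

definition norm_1 :: "real mat \<Rightarrow> real" where
  "norm_1 R = Max ((\<lambda>j. \<Sum>i<dim_row R. \<bar>R $$ (i, j)\<bar>) ` {..<dim_col R})"

definition max_density :: "real mat \<Rightarrow> real" where
  "max_density R =
     Max ((\<lambda>I. 1 / (2 * real (card I)) * (\<Sum>i\<in>I. \<Sum>j\<in>I. R $$ (i, j))) `
       {I. I \<subseteq> {..<dim_row R} \<and> I \<noteq> {}})"

text \<open>\<open>largest_eigenvalue\<close> takes a maximum over the real spectrum only. For nonnegative matrices this
  maximum exists and equals the spectral radius, by the following weak form of the
  Perron--Frobenius theorem.\<close>

lemma nonneg_pow_lower_bound: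
  fixes M :: "real mat"
  assumes M: "M \<in> carrier_mat n n" and nn: "\<And>i j. i < n \<Longrightarrow> j < n \<Longrightarrow> 0 \<le> M $$ (i, j)"
    and t: "0 \<le> t" and sup: "\<And>i. i < n \<Longrightarrow> t * y i \<le> (\<Sum>j<n. M $$ (i, j) * y j)"
    and i: "i < n"
  shows "t ^ k * y i \<le> (\<Sum>j<n. (M ^\<^sub>m k) $$ (i, j) * y j)
    \<and> (\<forall>j<n. 0 \<le> (M ^\<^sub>m k) $$ (i, j))"
  using i
proof (induction k arbitrary: i)
  case 0
  have "(\<Sum>j<n. (1\<^sub>m n) $$ (i, j) * y j) = (\<Sum>j<n. if j = i then y j else 0)"
    using 0 by (intro sum.cong) auto
  then show ?case using M 0 by (auto simp: sum.delta)
next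
  case (Suc k)
  have Mk: "M ^\<^sub>m k \<in> carrier_mat n n" using M by simp
  have ent: "(M ^\<^sub>m Suc k) $$ (i, j) = (\<Sum>l<n. (M ^\<^sub>m k) $$ (i, l) * M $$ (l, j))"
    if "j < n" for j
    using M Mk Suc.prems that by (simp add: scalar_prod_def atLeast0LessThan)
  have IH: "t ^ k * y i \<le> (\<Sum>j<n. (M ^\<^sub>m k) $$ (i, j) * y j)"
    "\<And>j. j < n \<Longrightarrow> 0 \<le> (M ^\<^sub>m k) $$ (i, j)"
    using Suc by blast+
  have "t ^ Suc k * y i \<le> t * (\<Sum>j<n. (M ^\<^sub>m k) $$ (i, j) * y j)"
    using mult_left_mono[OF IH(1) t] by (simp add: mult.assoc)
  also have "\<dots> = (\<Sum>l<n. (M ^\<^sub>m k) $$ (i, l) * (t * y l))"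
    by (simp add: sum_distrib_left ac_simps)
  also have "\<dots> \<le> (\<Sum>l<n. (M ^\<^sub>m k) $$ (i, l) * (\<Sum>j<n. M $$ (l, j) * y j))"
    using IH(2) sup by (intro sum_mono mult_left_mono) auto
  also have "\<dots> = (\<Sum>l<n. \<Sum>j<n. (M ^\<^sub>m k) $$ (i, l) * M $$ (l, j) * y j)"
    by (simp add: sum_distrib_left mult.assoc)
  also have "\<dots> = (\<Sum>j<n. \<Sum>l<n. (M ^\<^sub>m k) $$ (i, l) * M $$ (l, j) * y j)"
    by (rule sum.swap)
  also have "\<dots> = (\<Sum>j<n. (M ^\<^sub>m Suc k) $$ (i, j) * y j)"
    by (intro sum.cong refl) (simp add: ent sum_distrib_right del: pow_mat.simps)
  finally have "t ^ Suc k * y i \<le> (\<Sum>j<n. (M ^\<^sub>m Suc k) $$ (i, j) * y j)" .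
  moreover have "0 \<le> (M ^\<^sub>m Suc k) $$ (i, j)" if "j < n" for j
    unfolding ent[OF that] using IH(2) nn that by (intro sum_nonneg mult_nonneg_nonneg) auto
  ultimately show ?case by blast
qed

lemma eigenvector_iff_sum:
  fixes A :: "'a :: field mat"
  assumes A: "A \<in> carrier_mat n n"
  shows "eigenvector A v k \<longleftrightarrow> v \<in> carrier_vec n \<and> (\<exists>i<n. v $ i \<noteq> 0) \<and>
    (\<forall>i<n. (\<Sum>j<n. A $$ (i, j) * v $ j) = k * v $ i)"
proof (cases "v \<in> carrier_vec n")
  case v: True
  have "v \<noteq> 0\<^sub>v n \<longleftrightarrow> (\<exists>i<n. v $ i \<noteq> 0)"
    using v by (auto intro!: eq_vecI)
  moreover have "A *\<^sub>v v = k \<cdot>\<^sub>v v \<longleftrightarrow> (\<forall>i<n. (A *\<^sub>v v) $ i = (k \<cdot>\<^sub>v v) $ i)"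
    using A v by (auto simp del: index_mult_mat_vec index_smult_vec intro!: eq_vecI)
  moreover have "(A *\<^sub>v v) $ i = (\<Sum>j<n. A $$ (i, j) * v $ j)" if "i < n" for i
    using A v that by (simp add: scalar_prod_def atLeast0LessThan)
  ultimately show ?thesis
    using A v by (auto simp: eigenvector_def)
qed (use A in \<open>auto simp: eigenvector_def\<close>)

lemma spectral_radius_in_spectrum:
  assumes R: "R \<in> carrier_mat n n" and n: "0 < n"
    and nn: "\<And>i j. i < n \<Longrightarrow> j < n \<Longrightarrow> 0 \<le> R $$ (i, j)"
  shows "spectral_radius (map_mat complex_of_real R) \<in> spectrum R"
proof (rule ccontr)
  define RC where "RC = map_mat complex_of_real R"
  define r where "r = spectral_radius RC"
  have RC: "RC \<in> carrier_mat n n" using R by (simp add: RC_def)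
  assume "spectral_radius (map_mat complex_of_real R) \<notin> spectrum R"
  then have "poly (char_poly R) r \<noteq> 0"
    unfolding spectrum_root_char_poly[OF R] by (simp add: r_def RC_def)
  then have "poly (char_poly RC) (complex_of_real r) \<noteq> 0"
    unfolding RC_def of_real_hom.char_poly_hom[OF R] by simp
  then have rnot: "complex_of_real r \<notin> spectrum RC"
    unfolding spectrum_root_char_poly[OF RC] by simp
  obtain \<mu> where \<mu>: "\<mu> \<in> spectrum RC" "norm \<mu> = r"
    using spectral_radius_mem_max(1)[OF RC n] by (auto simp: r_def)
  have r0: "0 < r" using \<mu> rnot by (cases "\<mu> = 0") auto
  obtain v where "eigenvector RC v \<mu>" using \<mu>(1) by (auto simp: spectrum_def eigenvalue_def)
  then have v: "\<exists>i<n. v $ i \<noteq> 0" "\<And>i. i < n \<Longrightarrow> (\<Sum>j<n. RC $$ (i, j) * v $ j) = \<mu> * v $ i"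
    unfolding eigenvector_iff_sum[OF RC] by auto
  define y where "y = (\<lambda>i. cmod (v $ i))"
  have Ry: "r * y i \<le> (\<Sum>j<n. R $$ (i, j) * y j)" if i: "i < n" for i
  proof -
    have "r * y i = norm (\<Sum>j<n. RC $$ (i, j) * v $ j)"
      using v(2)[OF i] \<mu> by (simp add: y_def norm_mult)
    also have "\<dots> \<le> (\<Sum>j<n. norm (RC $$ (i, j) * v $ j))" by (rule norm_sum)
    also have "\<dots> = (\<Sum>j<n. R $$ (i, j) * y j)"
      using R i nn by (intro sum.cong refl) (simp add: y_def norm_mult RC_def)
    finally show ?thesis .
  qed
  define C where "C c = (1 / c) \<cdot>\<^sub>m (R + r \<cdot>\<^sub>m 1\<^sub>m n)" for c :: real
  have C: "C c \<in> carrier_mat n n" for c using R by (simp add: C_def)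
  have Cent: "C c $$ (i, j) = (R $$ (i, j) + (if i = j then r else 0)) / c"
    if "i < n" "j < n" for i j c using R that by (simp add: C_def)
  have CC: "map_mat complex_of_real (C c) \<in> carrier_mat n n" for c using C by simp
  have small: "norm (z + of_real r) < 2 * r" if z: "z \<in> spectrum RC" for z
  proof -
    have zr: "norm z \<le> r" using spectral_radius_mem_max(2)[OF RC n] z by (auto simp: r_def)
    have "z \<noteq> of_real r" using z rnot by auto
    moreover have "z = of_real r" if *: "2 * r \<le> norm (z + of_real r)"
    proof -
      have "Re z \<le> r" using zr complex_Re_le_cmod[of z] by simp
      have "(2 * r)\<^sup>2 \<le> (norm (z + of_real r))\<^sup>2" using * r0 by (intro power_mono) auto
      then have "4 * r\<^sup>2 \<le> (norm z)\<^sup>2 + 2 * r * Re z + r\<^sup>2"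
        unfolding cmod_power2 by (simp add: power2_eq_square algebra_simps)
      moreover have "(norm z)\<^sup>2 \<le> r\<^sup>2" using zr by (intro power_mono) auto
      ultimately have "2 * r * r \<le> 2 * r * Re z" by (simp add: power2_eq_square)
      then have "Re z = r" using r0 \<open>Re z \<le> r\<close> by simp
      moreover have "(Im z)\<^sup>2 \<le> 0"
        using \<open>(norm z)\<^sup>2 \<le> r\<^sup>2\<close> \<open>Re z = r\<close> by (simp add: cmod_power2)
      ultimately show ?thesis by (simp add: complex_eq_iff)
    qed
    ultimately show ?thesis by force
  qed
  have fin: "finite (spectrum RC)" using card_finite_spectrum[OF RC] by simp
  define m where "m = Max ((\<lambda>z. norm (z + of_real r)) ` spectrum RC)"
  have "m \<in> (\<lambda>z. norm (z + of_real r)) ` spectrum RC"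
    unfolding m_def using fin \<mu>(1) by (intro Max_in) auto
  then have m: "m < 2 * r" "\<And>z. z \<in> spectrum RC \<Longrightarrow> norm (z + of_real r) \<le> m"
    using fin small by (auto simp: m_def intro: Max_ge)
  have "0 \<le> m" using m(2)[OF \<mu>(1)] norm_ge_zero order_trans by blast
  define c where "c = (m + 2 * r) / 2"
  have c: "m < c" "c < 2 * r" "0 < c" using m(1) \<open>0 \<le> m\<close> r0 by (auto simp: c_def)
  have "spectral_radius (map_mat complex_of_real (C c)) < 1"
  proof -
    obtain w where w: "w \<in> spectrum (map_mat complex_of_real (C c))"
      "spectral_radius (map_mat complex_of_real (C c)) = norm w"
      using spectral_radius_mem_max(1)[OF CC n] by auto
    obtain x where "eigenvector (map_mat complex_of_real (C c)) x w"
      using w(1) by (auto simp: spectrum_def eigenvalue_def)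
    then have x: "x \<in> carrier_vec n" "\<exists>i<n. x $ i \<noteq> 0"
      "\<And>i. i < n \<Longrightarrow> (\<Sum>j<n. map_mat complex_of_real (C c) $$ (i, j) * x $ j) = w * x $ i"
      unfolding eigenvector_iff_sum[OF CC] by auto
    have "(\<Sum>j<n. RC $$ (i, j) * x $ j) = (c * w - r) * x $ i" if i: "i < n" for i
    proof -
      have "c * w * x $ i = (\<Sum>j<n. c * (map_mat complex_of_real (C c) $$ (i, j) * x $ j))"
        unfolding sum_distrib_left[symmetric] x(3)[OF i] by (rule mult.assoc)
      also have "\<dots> = (\<Sum>j<n. RC $$ (i, j) * x $ j + (if i = j then r * x $ j else 0))"
        using R C[of c] i c(3)
        by (intro sum.cong refl) (auto simp: RC_def Cent field_simps)
      also have "\<dots> = (\<Sum>j<n. RC $$ (i, j) * x $ j) + r * x $ i"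
        using i by (simp add: sum.distrib)
      finally show ?thesis by (simp add: algebra_simps)
    qed
    then have "eigenvector RC x (c * w - r)"
      unfolding eigenvector_iff_sum[OF RC] using x by auto
    then have "norm (c * w) \<le> m"
      using m(2)[of "c * w - r"] by (auto simp: spectrum_def eigenvalue_def)
    then have "c * norm w < c * 1" using c unfolding norm_mult norm_of_real by linarith
    then show ?thesis unfolding w(2) using c(3) by (rule mult_left_less_imp_less[OF _ less_imp_le])
  qed
  then obtain b where b: "\<And>k. norm_bound (map_mat complex_of_real (C c) ^\<^sub>m k) b"
    using spectral_radius_jnf_norm_bound_less_1_upper_triangular[OF CC] by blast
  have bR: "(C c ^\<^sub>m k) $$ (i, j) \<le> b" if "i < n" "j < n" for i j k
  proof -
    have "map_mat complex_of_real (C c) ^\<^sub>m k = map_mat complex_of_real (C c ^\<^sub>m k)"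
      by (rule of_real_hom.mat_hom_pow[OF C, symmetric])
    then have "norm (complex_of_real ((C c ^\<^sub>m k) $$ (i, j))) \<le> b"
      using b[of k] C[of c] that pow_carrier_mat[OF C, of c k] by (auto simp: norm_bound_def)
    then show ?thesis by simp
  qed
  obtain i where i: "i < n" "v $ i \<noteq> 0" using v(1) by auto
  have yi: "0 < y i" using i by (simp add: y_def)
  have step: "2 * r / c * y l \<le> (\<Sum>j<n. C c $$ (l, j) * y j)" if l: "l < n" for l
  proof -
    have "(\<Sum>j<n. C c $$ (l, j) * y j)
        = (\<Sum>j<n. R $$ (l, j) * y j / c + (if l = j then r * y j / c else 0))"
      using l by (intro sum.cong refl) (auto simp: Cent add_divide_distrib algebra_simps)
    also have "\<dots> = ((\<Sum>j<n. R $$ (l, j) * y j) + r * y l) / c"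
      using l by (simp add: sum.distrib add_divide_distrib sum_divide_distrib)
    also have "\<dots> \<ge> (r * y l + r * y l) / c"
      using Ry[OF l] c(3) by (intro divide_right_mono) auto
    finally show ?thesis by (simp add: field_simps)
  qed
  have grow: "(2 * r / c) ^ k * y i \<le> (\<Sum>j<n. b * y j)" for k
  proof -
    have "(2 * r / c) ^ k * y i \<le> (\<Sum>j<n. (C c ^\<^sub>m k) $$ (i, j) * y j)"
      using nonneg_pow_lower_bound[OF C _ _ step i(1)] nn r0 c(3) by (simp add: Cent)
    also have "\<dots> \<le> (\<Sum>j<n. b * y j)"
      using bR i(1) by (intro sum_mono mult_right_mono) (auto simp: y_def)
    finally show ?thesis .
  qed
  have "1 < 2 * r / c" using c by simp
  then obtain k where "(\<Sum>j<n. b * y j) / y i < (2 * r / c) ^ k"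
    using real_arch_pow by blast
  then show False using grow[of k] yi by (simp add: field_simps)
qed

lemma largest_eigenvalue_eq_spectral_radius:
  assumes R: "R \<in> carrier_mat n n" and n: "0 < n"
    and nn: "\<And>i j. i < n \<Longrightarrow> j < n \<Longrightarrow> 0 \<le> R $$ (i, j)"
  shows "largest_eigenvalue R = spectral_radius (map_mat complex_of_real R)"
  unfolding largest_eigenvalue_def
proof (rule Max_eqI)
  show "finite (spectrum R)" by (rule card_finite_spectrum[OF R])
  show "spectral_radius (map_mat complex_of_real R) \<in> spectrum R"
    by (rule spectral_radius_in_spectrum[OF R n nn])
next
  fix k assume "k \<in> spectrum R"
  then have "complex_of_real k \<in> spectrum (map_mat complex_of_real R)"
    using of_real_hom.eigenvalue_hom[OF R] by (auto simp: spectrum_def)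
  then have "norm (complex_of_real k) \<le> spectral_radius (map_mat complex_of_real R)"
    using R n by (intro spectral_radius_mem_max(2)[of _ n] imageI) auto
  then show "k \<le> spectral_radius (map_mat complex_of_real R)" by simp
qed

end

theory Submission
  imports Defs "HOL-Analysis.Convex"
begin

text \<open>Write \<open>\<kappa>\<close> and \<open>\<alpha>\<close> for the maximum density and the \<open>1\<close>-norm of \<open>R\<close>. Let \<open>v\<close> be an
  eigenvector for the eigenvalue \<open>k\<close>, put \<open>x\<^sub>i = \<bar>v\<^sub>i\<bar>\<close> and \<open>N = (\<Sum>i. x\<^sub>i\<^sup>2)\<close>. Multiplying the \<open>i\<close>-th
  eigenvalue equation by \<open>v\<^sub>i\<close> and summing gives \<open>\<bar>k\<bar> N \<le> (\<Sum>i j. R\<^sub>i\<^sub>j x\<^sub>i x\<^sub>j)\<close>. Since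
  \<open>x\<^sub>i x\<^sub>j = min x\<^sub>i x\<^sub>j * max x\<^sub>i x\<^sub>j\<close>, the Cauchy--Schwarz inequality yields \<open>(k N)\<^sup>2 \<le> m M\<close> with
  \<open>m = (\<Sum>i j. R\<^sub>i\<^sub>j min x\<^sub>i\<^sup>2 x\<^sub>j\<^sup>2)\<close> and \<open>M = (\<Sum>i j. R\<^sub>i\<^sub>j max x\<^sub>i\<^sup>2 x\<^sub>j\<^sup>2)\<close>.

  The sum \<open>m + M\<close> is at most \<open>2 \<alpha> N\<close>, because the row and column sums of \<open>R\<close> are at most \<open>\<alpha>\<close>.
  The sum \<open>m\<close> is a nonnegative combination of the sums of \<open>R\<close> over the squares \<open>I \<times> I\<close> of the
  superlevel sets \<open>I\<close> of \<open>x\<^sup>2\<close>, hence is at most \<open>2 \<kappa> N\<close>; this is the layer-cake argument of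
  \<open>sum_min_le_density\<close>. Finally \<open>2 \<kappa> \<le> \<alpha>\<close>, and \<open>p (2 \<alpha> N - p)\<close> increases for \<open>p \<le> \<alpha> N\<close>, so
  \<open>(k N)\<^sup>2 \<le> m (2 \<alpha> N - m) \<le> 2 \<kappa> N (2 \<alpha> N - 2 \<kappa> N)\<close>.\<close>

lemma sum_min_le_density:
  fixes r :: "'a \<Rightarrow> 'a \<Rightarrow> real"
  assumes "finite V"
    and "\<And>I. I \<subseteq> V \<Longrightarrow> (\<Sum>i\<in>I. \<Sum>j\<in>I. r i j) \<le> c * real (card I)"
    and "\<And>i. i \<in> V \<Longrightarrow> 0 \<le> f i"
  shows "(\<Sum>i\<in>V. \<Sum>j\<in>V. r i j * min (f i) (f j)) \<le> c * (\<Sum>i\<in>V. f i)"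
  using assms
proof (induction V arbitrary: f rule: finite_psubset_induct)
  case (psubset V)
  show ?case
  proof (cases "V = {}")
    case False
    \<comment> \<open>Peel off the bottom layer, of height \<open>t\<close>, which covers all of \<open>V\<close>; the rest of \<open>f\<close> lives
      on the proper subset \<open>W\<close>.\<close>
    define t where "t = Min (f ` V)"
    define W where "W = {i \<in> V. f i \<noteq> t}"
    have t: "t \<le> f i" if "i \<in> V" for i
      using that psubset.hyps by (simp add: t_def)
    have "t \<in> f ` V"
      unfolding t_def using False psubset.hyps by (intro Min_in) auto
    then have W: "W \<subset> V" and t0: "0 \<le> t"
      using psubset.prems(2) by (auto simp: W_def)
    have V_minus_W: "f i = t" if "i \<in> V - W" for i
      using that by (auto simp: W_def)
    have "(\<Sum>i\<in>V. \<Sum>j\<in>V. r i j * min (f i) (f j))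
        = (\<Sum>i\<in>V. \<Sum>j\<in>V. t * r i j + r i j * min (f i - t) (f j - t))"
      by (intro sum.cong refl) (simp add: min_def algebra_simps)
    also have "\<dots> = t * (\<Sum>i\<in>V. \<Sum>j\<in>V. r i j)
        + (\<Sum>i\<in>V. \<Sum>j\<in>V. r i j * min (f i - t) (f j - t))"
      by (simp add: sum.distrib sum_distrib_left)
    also have "(\<Sum>i\<in>V. \<Sum>j\<in>V. r i j * min (f i - t) (f j - t))
        = (\<Sum>i\<in>W. \<Sum>j\<in>W. r i j * min (f i - t) (f j - t))"
    proof -
      have "(\<Sum>j\<in>V. r i j * min (f i - t) (f j - t))
          = (\<Sum>j\<in>W. r i j * min (f i - t) (f j - t))" if "i \<in> V" for i
        using W psubset.hyps V_minus_W t[OF that]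
        by (intro sum.mono_neutral_right) (auto simp: min_def)
      moreover have "(\<Sum>j\<in>W. r i j * min (f i - t) (f j - t)) = 0" if "i \<in> V - W" for i
        using W V_minus_W[OF that] t by (intro sum.neutral) (auto simp: min_def)
      then have "(\<Sum>i\<in>V. \<Sum>j\<in>W. r i j * min (f i - t) (f j - t))
          = (\<Sum>i\<in>W. \<Sum>j\<in>W. r i j * min (f i - t) (f j - t))"
        using W psubset.hyps by (intro sum.mono_neutral_right) auto
      ultimately show ?thesis by simp
    qed
    also have "\<dots> \<le> c * (\<Sum>i\<in>W. f i - t)"
      using W t by (intro psubset.IH psubset.prems(1)) auto
    also have "(\<Sum>i\<in>W. f i - t) = (\<Sum>i\<in>V. f i - t)"
      using W psubset.hyps V_minus_W by (intro sum.mono_neutral_left) auto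
    also have "t * (\<Sum>i\<in>V. \<Sum>j\<in>V. r i j) \<le> t * (c * real (card V))"
      using psubset.prems(1)[of V] t0 by (intro mult_left_mono) auto
    finally show ?thesis
      by (simp add: sum_subtractf algebra_simps)
  qed simp
qed

lemma sum_mult_sq_le_sum_min_sum_max:
  fixes r :: "'a \<Rightarrow> 'a \<Rightarrow> real"
  assumes r: "\<And>i j. i \<in> V \<Longrightarrow> j \<in> V \<Longrightarrow> 0 \<le> r i j"
    and x: "\<And>i. i \<in> V \<Longrightarrow> 0 \<le> x i"
  shows "(\<Sum>i\<in>V. \<Sum>j\<in>V. r i j * x i * x j)\<^sup>2
    \<le> (\<Sum>i\<in>V. \<Sum>j\<in>V. r i j * min ((x i)\<^sup>2) ((x j)\<^sup>2))
      * (\<Sum>i\<in>V. \<Sum>j\<in>V. r i j * max ((x i)\<^sup>2) ((x j)\<^sup>2))"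
proof -
  define a where "a = (\<lambda>(i, j). sqrt (r i j) * min (x i) (x j))"
  define b where "b = (\<lambda>(i, j). sqrt (r i j) * max (x i) (x j))"
  have "(\<Sum>i\<in>V. \<Sum>j\<in>V. r i j * x i * x j) = (\<Sum>p\<in>V \<times> V. a p * b p)"
    unfolding sum.cartesian_product using r
    by (intro sum.cong refl) (auto simp: a_def b_def min_def max_def mult_ac)
  moreover have "(\<Sum>i\<in>V. \<Sum>j\<in>V. r i j * min ((x i)\<^sup>2) ((x j)\<^sup>2)) = (\<Sum>p\<in>V \<times> V. (a p)\<^sup>2)"
    unfolding sum.cartesian_product using r x
    by (intro sum.cong refl)
      (auto simp: a_def min_def power_mult_distrib power2_le_iff_abs_le)
  moreover have "(\<Sum>i\<in>V. \<Sum>j\<in>V. r i j * max ((x i)\<^sup>2) ((x j)\<^sup>2)) = (\<Sum>p\<in>V \<times> V. (b p)\<^sup>2)"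
    unfolding sum.cartesian_product using r x
    by (intro sum.cong refl)
      (auto simp: b_def max_def power_mult_distrib power2_le_iff_abs_le)
  ultimately show ?thesis
    by (simp add: Cauchy_Schwarz_ineq_sum)
qed

lemma col_sum_le_norm_1:
  assumes "R \<in> carrier_mat n n" and "j < n"
    and "\<And>i j. i < n \<Longrightarrow> j < n \<Longrightarrow> 0 \<le> R $$ (i, j)"
  shows "(\<Sum>i<n. R $$ (i, j)) \<le> norm_1 R"
proof -
  have "(\<Sum>i<n. R $$ (i, j)) = (\<Sum>i<dim_row R. \<bar>R $$ (i, j)\<bar>)"
    using assms by (intro sum.cong) auto
  also have "\<dots> \<le> norm_1 R"
    unfolding norm_1_def using assms(1,2) by (intro Max_ge) auto
  finally show ?thesis .
qed

lemma sum_le_max_density: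
  assumes "R \<in> carrier_mat n n" and "I \<subseteq> {..<n}"
  shows "(\<Sum>i\<in>I. \<Sum>j\<in>I. R $$ (i, j)) \<le> 2 * max_density R * real (card I)"
proof (cases "I = {}")
  case False
  have "finite I" using assms(2) finite_subset by blast
  then have "0 < card I" using False by auto
  have "1 / (2 * real (card I)) * (\<Sum>i\<in>I. \<Sum>j\<in>I. R $$ (i, j)) \<le> max_density R"
    unfolding max_density_def using assms False by (intro Max_ge) auto
  then show ?thesis using \<open>0 < card I\<close> by (simp add: field_simps)
qed simp

lemma max_density_le_half_norm_1:
  assumes R: "R \<in> carrier_mat n n" and n: "0 < n"
    and nn: "\<And>i j. i < n \<Longrightarrow> j < n \<Longrightarrow> 0 \<le> R $$ (i, j)"
  shows "2 * max_density R \<le> norm_1 R"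
proof -
  let ?A = "{I. I \<subseteq> {..<dim_row R} \<and> I \<noteq> {}}"
  have "{..<n} \<in> ?A" using R n by auto
  then have "max_density R \<in> (\<lambda>I. 1 / (2 * real (card I)) * (\<Sum>i\<in>I. \<Sum>j\<in>I. R $$ (i, j))) ` ?A"
    unfolding max_density_def by (intro Max_in) auto
  then obtain I where I: "I \<subseteq> {..<n}" "I \<noteq> {}"
    and d: "max_density R = 1 / (2 * real (card I)) * (\<Sum>i\<in>I. \<Sum>j\<in>I. R $$ (i, j))"
    using R by auto
  have "finite I" using I(1) finite_subset by blast
  then have c: "0 < card I" using I(2) by auto
  have "(\<Sum>i\<in>I. \<Sum>j\<in>I. R $$ (i, j)) = (\<Sum>j\<in>I. \<Sum>i\<in>I. R $$ (i, j))"
    by (rule sum.swap)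
  also have "\<dots> \<le> (\<Sum>j\<in>I. norm_1 R)"
  proof (rule sum_mono)
    fix j assume "j \<in> I"
    then have "j < n" using I(1) by auto
    have "(\<Sum>i\<in>I. R $$ (i, j)) \<le> (\<Sum>i<n. R $$ (i, j))"
      using I(1) nn \<open>j < n\<close> by (intro sum_mono2) auto
    also have "\<dots> \<le> norm_1 R"
      by (rule col_sum_le_norm_1[OF R \<open>j < n\<close> nn])
    finally show "(\<Sum>i\<in>I. R $$ (i, j)) \<le> norm_1 R" .
  qed
  finally show ?thesis using c by (simp add: d field_simps)
qed

lemma eigenvalue_sq_le:
  assumes R: "R \<in> carrier_mat n n" and n: "0 < n" and sym: "transpose_mat R = R"
    and nn: "\<And>i j. i < n \<Longrightarrow> j < n \<Longrightarrow> 0 \<le> R $$ (i, j)"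
    and k: "eigenvalue R k"
  shows "k\<^sup>2 \<le> 4 * (max_density R * (norm_1 R - max_density R))"
proof -
  define \<kappa> \<alpha> where "\<kappa> = max_density R" and "\<alpha> = norm_1 R"
  have R_sym: "R $$ (i, j) = R $$ (j, i)" if "i < n" "j < n" for i j
    using that R index_transpose_mat(1)[of i R j] by (simp add: sym)
  obtain v where "eigenvector R v k" using k by (auto simp: eigenvalue_def)
  then have v: "\<exists>i<n. v $ i \<noteq> 0" "\<And>i. i < n \<Longrightarrow> (\<Sum>j<n. R $$ (i, j) * v $ j) = k * v $ i"
    unfolding eigenvector_iff_sum[OF R] by auto
  define x where "x i = \<bar>v $ i\<bar>" for i
  define N where "N = (\<Sum>i<n. (x i)\<^sup>2)"
  define m where "m = (\<Sum>i<n. \<Sum>j<n. R $$ (i, j) * min ((x i)\<^sup>2) ((x j)\<^sup>2))"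
  define M where "M = (\<Sum>i<n. \<Sum>j<n. R $$ (i, j) * max ((x i)\<^sup>2) ((x j)\<^sup>2))"
  have N: "0 < N"
    unfolding N_def using v(1) by (auto simp: x_def intro: sum_pos2)
  have "k * N = (\<Sum>i<n. v $ i * (\<Sum>j<n. R $$ (i, j) * v $ j))"
    unfolding N_def sum_distrib_left
    by (intro sum.cong refl) (simp add: v(2) x_def power2_eq_square flip: sum_distrib_left)
  then have "\<bar>k\<bar> * N = \<bar>\<Sum>i<n. v $ i * (\<Sum>j<n. R $$ (i, j) * v $ j)\<bar>"
    using N by (metis abs_mult abs_of_pos)
  also have "\<dots> \<le> (\<Sum>i<n. \<Sum>j<n. \<bar>v $ i * (R $$ (i, j) * v $ j)\<bar>)"
    unfolding sum_distrib_left by (intro order_trans[OF sum_abs] sum_mono sum_abs)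
  also have "\<dots> = (\<Sum>i<n. \<Sum>j<n. R $$ (i, j) * x i * x j)"
    using nn by (intro sum.cong refl) (simp add: x_def abs_mult)
  finally have "(\<bar>k\<bar> * N)\<^sup>2 \<le> (\<Sum>i<n. \<Sum>j<n. R $$ (i, j) * x i * x j)\<^sup>2"
    using N by (intro power_mono) auto
  also have "\<dots> \<le> m * M"
    unfolding m_def M_def using nn by (intro sum_mult_sq_le_sum_min_sum_max) (auto simp: x_def)
  finally have kN: "(k * N)\<^sup>2 \<le> m * M"
    by (simp add: power_mult_distrib)
  have m0: "0 \<le> m"
    unfolding m_def using nn by (intro sum_nonneg mult_nonneg_nonneg) auto
  have m_le: "m \<le> 2 * \<kappa> * N"
    unfolding m_def N_def \<kappa>_def using sum_le_max_density[OF R]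
    by (intro sum_min_le_density) auto
  have M_le: "M \<le> 2 * \<alpha> * N - m"
  proof -
    have "m + M = (\<Sum>i<n. \<Sum>j<n. R $$ (i, j) * (x i)\<^sup>2) + (\<Sum>i<n. \<Sum>j<n. R $$ (i, j) * (x j)\<^sup>2)"
      unfolding m_def M_def sum.distrib[symmetric]
      by (intro sum.cong refl) (simp add: min_def max_def)
    also have "(\<Sum>i<n. \<Sum>j<n. R $$ (i, j) * (x i)\<^sup>2) = (\<Sum>i<n. \<Sum>j<n. R $$ (j, i) * (x i)\<^sup>2)"
      using R_sym by (intro sum.cong refl) auto
    also have "(\<Sum>i<n. \<Sum>j<n. R $$ (i, j) * (x j)\<^sup>2) = (\<Sum>i<n. \<Sum>j<n. R $$ (j, i) * (x i)\<^sup>2)"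
      by (rule sum.swap)
    also have "(\<Sum>i<n. \<Sum>j<n. R $$ (j, i) * (x i)\<^sup>2) \<le> (\<Sum>i<n. \<alpha> * (x i)\<^sup>2)"
      unfolding sum_distrib_right[symmetric] \<alpha>_def using col_sum_le_norm_1[OF R _ nn]
      by (intro sum_mono mult_right_mono) auto
    finally show ?thesis by (simp add: N_def mult.assoc flip: sum_distrib_left)
  qed
  have "2 * \<kappa> * N \<le> \<alpha> * N"
    using max_density_le_half_norm_1[OF R n nn] N by (simp add: \<kappa>_def \<alpha>_def)
  then have "0 \<le> (2 * \<kappa> * N - m) * (2 * \<alpha> * N - 2 * \<kappa> * N - m)"
    using m_le by (intro mult_nonneg_nonneg) auto
  moreover have "m * M \<le> m * (2 * \<alpha> * N - m)"
    using M_le m0 by (rule mult_left_mono)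
  ultimately have "k\<^sup>2 * N\<^sup>2 \<le> 4 * (\<kappa> * (\<alpha> - \<kappa>)) * N\<^sup>2"
    using kN by (simp add: power2_eq_square algebra_simps)
  then show ?thesis using N by (simp add: \<kappa>_def \<alpha>_def)
qed

theorem theorem44:
  fixes R :: "real mat" and n :: nat and \<kappa> \<alpha> :: real
  assumes "R \<in> carrier_mat n n" and "0 < n"
    and "transpose_mat R = R"
    and "\<And>i j. i < n \<Longrightarrow> j < n \<Longrightarrow> 0 \<le> R $$ (i, j)"
    and "\<kappa> = max_density R" and "\<alpha> = norm_1 R"
  shows "largest_eigenvalue R \<le> 2 * sqrt (\<kappa> * (\<alpha> - \<kappa>))"
proof -
  have "largest_eigenvalue R \<in> spectrum R"
    unfolding largest_eigenvalue_def
    using card_finite_spectrum(1)[OF assms(1)] spectral_radius_in_spectrum[OF assms(1,2,4)]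
    by (intro Max_in) auto
  then have "(largest_eigenvalue R)\<^sup>2 \<le> 4 * (\<kappa> * (\<alpha> - \<kappa>))"
    using eigenvalue_sq_le[OF assms(1-4)] by (simp add: assms(5,6) spectrum_def)
  then have "largest_eigenvalue R \<le> sqrt (4 * (\<kappa> * (\<alpha> - \<kappa>)))"
    by (rule real_le_rsqrt)
  then show ?thesis by (simp add: real_sqrt_mult)
qed

end
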